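(* Let $m\ge 2$ be an integer and let $(s_k)_{k\in\mathbb Z}$ be a sequence of complex numbers satisfying the standing assumptions (S1)–(S4) stated in the context, with characteristic polynomial $\mathcal{CP}(x)=x^m-a_mx^{m-1}-\cdots-a_2x-a_1$. Let $P(x)\in\mathbb C[x]$ be a polynomial and let $h,r$ be integers such that $h\neq 0$ and the $h$-th powers of the $m$ roots of $\mathcal{CP}(x)$ are pairwise distinct and all not equal to $1$. Then there exist $m+1$ polynomials $P_1(x),P_2(x),\ldots,P_{m+1}(x)\in\mathbb C[x]$ such that $$\sum_{k=1}^{n}P(k)\,s_{hk+r}=\Big[\sum_{k=1}^{m}P_k(n)\,s_{(n+k)h+r}\Big]+P_{m+1}(n)\qquad\text{for all } n\in\mathbb N.$$
   Context: $\mathbb N$ denotes the set of positive integers. Standing assumptions on the bi-infinite complex sequence $(s_k)_{k\in\mathbb Z}$, for a fixed integer $m\ge 2$: (S1) There are complex numbers $a_1,a_2,\ldots,a_m$ with $a_1\ne 0$ such that $s_{k+m}=a_ms_{k+m-1}+a_{m-1}s_{k+m-2}+\cdots+a_2s_{k+1}+a_1s_k$ for all $k\in\mathbb Z$. (S2) $(s_k)_{k\in\mathbb Z}$ does not satisfy any homogeneous linear recurrence relation with constant complex coefficients of degree (order) less than $m$, i.e. $m$ is the minimal degree. (S3) $s_1,s_2,\ldots,s_m$ are not simultaneously zero. (S4) The characteristic polynomial $\mathcal{CP}(x)=x^m-a_mx^{m-1}-a_{m-1}x^{m-2}-\cdots-a_2x-a_1$ has $m$ distinct roots in $\mathbb C$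 (all nonzero, since $a_1\neq0$). *)

theory Defs
  imports Complex_Main "HOL-Computational_Algebra.Polynomial"
begin

text \<open>
  Coefficients are indexed from 1: the recurrence of order \<open>d\<close> is
  \<open>s (k+d) = a d * s (k+d-1) + ... + a 2 * s (k+1) + a 1 * s k\<close>.
  The trailing coefficient \<open>a 1\<close> may vanish here; order 0 says that \<open>s\<close> is identically zero.
\<close>
definition lin_rec :: "(int \<Rightarrow> complex) \<Rightarrow> nat \<Rightarrow> (nat \<Rightarrow> complex) \<Rightarrow> bool" where
  "lin_rec s d a \<longleftrightarrow>
     (\<forall>k::int. s (k + int d) = (\<Sum>i=1..d. a i * s (k + int i - 1)))"

definition rec_char_poly :: "nat \<Rightarrow> (nat \<Rightarrow> complex) \<Rightarrow> complex poly" where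
  "rec_char_poly m a = monom 1 m - (\<Sum>i=1..m. monom (a i) (i - 1))"

definition rec_roots :: "nat \<Rightarrow> (nat \<Rightarrow> complex) \<Rightarrow> complex set" where
  "rec_roots m a = {x. poly (rec_char_poly m a) x = 0}"

end

theory Submission imports Defs begin

text \<open>
  Because the characteristic roots are simple and nonzero, Binet's formula (\<open>binet_formula\<close>) writes
  \<open>s k\<close> as a combination of the progressions \<open>x powi k\<close>, one for each root \<open>x\<close>. Along the indices
  \<open>h k + r\<close> these become the progressions \<open>y\<^sup>k\<close> with \<open>y = x powi h\<close>, and everything reduces to two
  independent facts about the numbers \<open>y\<close>.

  Since \<open>y \<noteq> 1\<close>, the sum of \<open>P(k) y\<^sup>k\<close> over \<open>k = 1, \<dots>, n\<close> has a closed form \<open>R(n) y\<^sup>n - R(0)\<close> with a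
  polynomial \<open>R\<close> depending on \<open>y\<close> (\<open>sum_poly_times_power\<close>). So the left-hand side is
  a combination of the \<open>R\<^sub>y(n) y\<^sup>n\<close>, plus a constant.

  It remains to recover these terms from the window \<open>s ((n+1)h+r), \<dots>, s ((n+m)h+r)\<close> without
  separating the progressions. It suffices to find polynomials \<open>Q\<^sub>k\<close>, common to all \<open>y\<close>, such
  that the sum of \<open>Q\<^sub>k(n) y\<^sup>k\<close> over \<open>k = 1, \<dots>, m\<close> equals \<open>R\<^sub>y(n)\<close> for each of the \<open>m\<close> numbers
  \<open>y\<close>. This is Lagrange interpolation with coefficients in the polynomials in \<open>n\<close>, and it is
  possible because the \<open>y\<close> are distinct and nonzero (\<open>interpolate_by_shifted_powers\<close>). The last
  polynomial of the theorem is then a constant.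
\<close>

section \<open>Summing a polynomial against a geometric progression\<close>

text \<open>
  The shift \<open>p(x) \<mapsto> p(x + 1)\<close> keeps degree and leading coefficient, so the leading terms cancel.
\<close>

lemma degree_shift_diff_less:
  fixes p :: "complex poly"
  assumes "degree p > 0"
  shows "degree (pcompose p [:1, 1:] - p) < degree p"
proof -
  have "degree (pcompose p [:1, 1:] - p) \<le> degree p"
    by (rule degree_diff_le) (simp_all add: degree_pcompose)
  moreover have "coeff (pcompose p [:1, 1:]) (degree p) = coeff p (degree p)"
    using lead_coeff_comp[of "[:1, 1:] :: complex poly" p] by (simp add: degree_pcompose)
  then have "coeff (pcompose p [:1, 1:] - p) (degree p) = 0"
    by simp
  ultimately show ?thesis
    using assms by (metis degree_0 le_neq_implies_less leading_coeff_0_iff)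
qed

text \<open>
  Write \<open>\<Delta> p = p(x + 1) - p(x)\<close>. The operator in question is \<open>q \<mapsto> (y - 1) q + y \<Delta> q\<close>: an invertible
  scalar plus an operator that lowers the degree. Dividing \<open>p\<close> by \<open>y - 1\<close> therefore
  solves the equation up to the error \<open>(y / (y - 1)) \<Delta> p\<close> of smaller degree, which induction removes.
\<close>

lemma twisted_difference_surj:
  fixes p :: "complex poly"
  assumes "y \<noteq> 1"
  shows "\<exists>q. smult y (pcompose q [:1, 1:]) - q = p"
proof (induction "degree p" arbitrary: p rule: less_induct)
  case less
  \<comment> \<open>what is left over when \<open>p / (y - 1)\<close> is tried as a solution\<close>
  let ?d = "smult (y / (y - 1)) (pcompose p [:1, 1:] - p)"
  have "\<exists>q. smult y (pcompose q [:1, 1:]) - q = ?d"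
  proof (cases "degree p = 0")
    case True
    then obtain c where "p = [:c:]"
      by (auto elim: degree_eq_zeroE)
    then have "?d = 0"
      by (simp add: pcompose_pCons)
    then show ?thesis
      by (intro exI[of _ 0]) simp
  next
    case False
    then have "degree ?d < degree p"
      using degree_shift_diff_less[of p] le_less_trans[OF degree_smult_le] by blast
    then show ?thesis
      by (rule less)
  qed
  then obtain q where q: "smult y (pcompose q [:1, 1:]) - q = ?d"
    by blast
  let ?q = "smult (1 / (y - 1)) p - q"
  have "smult y (pcompose ?q [:1, 1:]) - ?q
      = smult (y / (y - 1)) (pcompose p [:1, 1:]) - smult (1 / (y - 1)) p
        - (smult y (pcompose q [:1, 1:]) - q)"
    by (simp add: pcompose_diff pcompose_smult smult_diff_right)
  also have "\<dots> = smult (y / (y - 1)) p - smult (1 / (y - 1)) p"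
    unfolding q by (simp add: smult_diff_right)
  also have "\<dots> = smult (y / (y - 1) - 1 / (y - 1)) p"
    by (simp add: smult_diff_left)
  also have "y / (y - 1) - 1 / (y - 1) = 1"
    using assms by (simp add: diff_divide_distrib[symmetric])
  finally show ?case
    by (intro exI[of _ ?q]) simp
qed

text \<open>
  This is telescoping: \<open>R\<close> is chosen so that \<open>R(k) y\<^sup>k - R(k - 1) y\<^sup>k\<^sup>-\<^sup>1 = P(k) y\<^sup>k\<close>.
\<close>

lemma sum_poly_times_power:
  fixes P :: "complex poly"
  assumes "y \<noteq> 1"
  shows "\<exists>R. \<forall>n::nat. (\<Sum>k=1..n. poly P (of_nat k) * y ^ k)
                        = poly R (of_nat n) * y ^ n - poly R 0"
proof -
  obtain R where R: "smult y (pcompose R [:1, 1:]) - R = smult y (pcompose P [:1, 1:])"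
    using twisted_difference_surj[OF assms] by blast
  have step: "y * poly R (1 + z) - poly R z = y * poly P (1 + z)" for z
    using arg_cong[OF R, of "\<lambda>p. poly p z"] by (simp add: poly_pcompose)
  have "(\<Sum>k=1..n. poly P (of_nat k) * y ^ k) = poly R (of_nat n) * y ^ n - poly R 0" for n :: nat
  proof (induction n)
    case (Suc n)
    have "poly R (1 + of_nat n) * y ^ Suc n - poly R (of_nat n) * y ^ n
        = (y * poly R (1 + of_nat n) - poly R (of_nat n)) * y ^ n"
      by (simp add: algebra_simps)
    also have "\<dots> = poly P (1 + of_nat n) * y ^ Suc n"
      unfolding step by simp
    finally show ?case
      using Suc.IH by (simp add: algebra_simps)
  qed simp
  then show ?thesis
    by blast
qed

section \<open>Lagrange interpolation\<close>

lemma lagrange_basis_exists: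
  fixes A :: "complex set"
  assumes "finite A"
  shows "\<exists>L. (\<forall>x\<in>A. degree (L x) < card A)
           \<and> (\<forall>x\<in>A. \<forall>z\<in>A. poly (L x) z = (if z = x then 1 else 0))"
proof -
  define N where "N x = (\<Prod>w\<in>A - {x}. [:- w, 1:])" for x
  define L where "L x = smult (1 / poly (N x) x) (N x)" for x
  have N: "poly (N x) z = (\<Prod>w\<in>A - {x}. z - w)" for x z
    by (simp add: N_def poly_prod)
  have "degree (L x) < card A" if x: "x \<in> A" for x
  proof -
    have "degree (N x) \<le> card (A - {x})"
      unfolding N_def using degree_prod_sum_le[of "A - {x}" "\<lambda>w. [:- w, 1:]"] assms by simp
    also have "\<dots> < card A"
      using assms x by (rule card_Diff1_less)
    finally show ?thesis
      unfolding L_def using degree_smult_le le_less_trans by blast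
  qed
  moreover have "poly (L x) z = (if z = x then 1 else 0)" if "z \<in> A" for x z
    using assms that by (auto simp: L_def N)
  ultimately show ?thesis
    by (intro exI[of _ L]) simp
qed

section \<open>Recurrences with simple characteristic roots\<close>

lemma lin_rec_diff:
  assumes "lin_rec s d a" "lin_rec t d a"
  shows "lin_rec (\<lambda>k. s k - t k) d a"
  using assms by (simp add: lin_rec_def sum_subtractf[symmetric] right_diff_distrib)

lemma lin_rec_sum:
  assumes "\<And>x. x \<in> A \<Longrightarrow> lin_rec (t x) d a"
  shows "lin_rec (\<lambda>k. \<Sum>x\<in>A. c x * t x k) d a"
  unfolding lin_rec_def
proof
  fix k
  have "(\<Sum>x\<in>A. c x * t x (k + int d)) = (\<Sum>x\<in>A. \<Sum>i=1..d. a i * (c x * t x (k + int i - 1)))"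
    using assms by (intro sum.cong) (auto simp: lin_rec_def sum_distrib_left mult_ac)
  also have "\<dots> = (\<Sum>i=1..d. a i * (\<Sum>x\<in>A. c x * t x (k + int i - 1)))"
    by (subst sum.swap) (simp add: sum_distrib_left)
  finally show "(\<Sum>x\<in>A. c x * t x (k + int d))
      = (\<Sum>i=1..d. a i * (\<Sum>x\<in>A. c x * t x (k + int i - 1)))" .
qed

text \<open>
  A block of \<open>m\<close> consecutive zeros moves one place to the right by the recurrence itself, and one
  place to the left because the recurrence can be solved for its lowest term when \<open>a 1 \<noteq> 0\<close>.
\<close>

lemma lin_rec_eq_0:
  assumes rec: "lin_rec t m a" and m: "m \<ge> 1" and a1: "a 1 \<noteq> 0"
    and init: "\<And>k. k < m \<Longrightarrow> t (int k) = 0"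
  shows "t k = 0"
proof -
  have rec: "t (k + int m) = (\<Sum>i=1..m. a i * t (k + int i - 1))" for k
    using rec by (simp add: lin_rec_def)
  have "\<forall>j<m. t (k + int j) = 0" for k
  proof (induction k rule: int_induct[where k = 0])
    case base
    then show ?case using init by simp
  next
    case (step1 k)
    have "(\<Sum>i=1..m. a i * t (k + int i - 1)) = 0"
    proof (rule sum.neutral, rule ballI)
      fix i assume "i \<in> {1..m}"
      then have i: "i - 1 < m" "k + int i - 1 = k + int (i - 1)"
        by auto
      show "a i * t (k + int i - 1) = 0"
        unfolding i(2) using step1(2) i(1) by simp
    qed
    then have last: "t (k + int m) = 0"
      using rec by simp
    show ?case
    proof (intro allI impI)
      fix j assume "j < m"
      then consider "j + 1 < m" | "j + 1 = m" by linarith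
      then show "t (k + 1 + int j) = 0"
      proof cases
        case 1
        then have "t (k + int (j + 1)) = 0" using step1 by blast
        then show ?thesis by (simp add: add_ac)
      next
        case 2
        then show ?thesis using last by (simp add: add_ac flip: 2)
      qed
    qed
  next
    case (step2 k)
    have "t (k - 1 + int m) = 0"
      using step2(2)[rule_format, of "m - 1"] m by (simp add: of_nat_diff algebra_simps)
    moreover have "(\<Sum>i=1..m. a i * t (k - 1 + int i - 1))
        = a 1 * t (k - 1) + (\<Sum>i=Suc 1..m. a i * t (k - 1 + int i - 1))"
      using m by (subst sum.atLeast_Suc_atMost) simp_all
    moreover have "(\<Sum>i=Suc 1..m. a i * t (k - 1 + int i - 1)) = 0"
    proof (rule sum.neutral, rule ballI)
      fix i assume "i \<in> {Suc 1..m}"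
      then have i: "i - 2 < m" "k - 1 + int i - 1 = k + int (i - 2)"
        by auto
      show "a i * t (k - 1 + int i - 1) = 0"
        unfolding i(2) using step2(2) i(1) by simp
    qed
    ultimately have first: "t (k - 1) = 0"
      using rec[of "k - 1"] a1 by simp
    show ?case
    proof (intro allI impI)
      fix j assume j: "j < m"
      show "t (k - 1 + int j) = 0"
      proof (cases j)
        case 0
        then show ?thesis using first by simp
      next
        case (Suc i)
        then show ?thesis using step2(2)[rule_format, of i] j by simp
      qed
    qed
  qed
  from this[of k] show ?thesis
    using m by auto
qed

lemma poly_rec_char_poly:
  "poly (rec_char_poly m a) x = x ^ m - (\<Sum>i=1..m. a i * x ^ (i - 1))"
  by (simp add: rec_char_poly_def poly_sum poly_monom)

lemma rec_roots_nonzero: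
  assumes "m \<ge> 1" "a 1 \<noteq> 0" "x \<in> rec_roots m a"
  shows "x \<noteq> 0"
proof
  assume "x = 0"
  then have "(\<Sum>i=1..m. a i * 0 ^ (i - 1)) = 0"
    using assms by (simp add: rec_roots_def poly_rec_char_poly power_0_left)
  moreover have "(\<Sum>i=1..m. a i * 0 ^ (i - 1)) = a 1"
    using assms(1) by (subst sum.atLeast_Suc_atMost) (auto intro!: sum.neutral)
  ultimately show False
    using assms(2) by simp
qed

lemma lin_rec_powi:
  assumes "x \<in> rec_roots m a" "x \<noteq> 0"
  shows "lin_rec (\<lambda>k. x powi k) m a"
  unfolding lin_rec_def
proof
  fix k :: int
  have "x powi (k + int m) = x powi k * (\<Sum>i=1..m. a i * x ^ (i - 1))"
    using assms by (simp add: power_int_add rec_roots_def poly_rec_char_poly)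
  also have "\<dots> = (\<Sum>i=1..m. a i * (x powi k * x ^ (i - 1)))"
    by (simp add: sum_distrib_left mult_ac)
  also have "\<dots> = (\<Sum>i=1..m. a i * x powi (k + int i - 1))"
  proof (intro sum.cong refl)
    fix i assume "i \<in> {1..m}"
    then have i: "k + int i - 1 = k + int (i - 1)"
      by auto
    show "a i * (x powi k * x ^ (i - 1)) = a i * x powi (k + int i - 1)"
      unfolding i using assms(2) power_int_add[of x k "int (i - 1)"] by simp
  qed
  finally show "x powi (k + int m) = (\<Sum>i=1..m. a i * x powi (k + int i - 1))" .
qed

text \<open>
  Both sides satisfy the recurrence, so by \<open>lin_rec_eq_0\<close> it is enough to make them agree at
  \<open>k = 0, \<dots>, m - 1\<close>. This asks for the inverse of a Vandermonde matrix, whose entries are the coefficients of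
  the Lagrange basis at the roots: interpolating the polynomial \<open>X\<^sup>k\<close> of degree less than \<open>m\<close> at
  the \<open>m\<close> roots gives \<open>X\<^sup>k\<close> back, and one then replaces each \<open>X\<^sup>l\<close> by \<open>s l\<close>.
\<close>

lemma binet_formula:
  assumes rec: "lin_rec s m a" and m: "m \<ge> 1" and a1: "a 1 \<noteq> 0"
    and card: "card (rec_roots m a) = m"
  shows "\<exists>c. \<forall>k. s k = (\<Sum>x\<in>rec_roots m a. c x * x powi k)"
proof -
  let ?X = "rec_roots m a"
  have fin: "finite ?X"
    using card m by (intro card_ge_0_finite) simp
  obtain L where degL: "\<forall>x\<in>?X. degree (L x) < m"
    and polyL: "\<forall>x\<in>?X. \<forall>z\<in>?X. poly (L x) z = (if z = x then 1 else 0)"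
    using lagrange_basis_exists[OF fin] unfolding card by blast
  have expand: "(\<Sum>x\<in>?X. smult (x ^ k) (L x)) = monom 1 k" if k: "k < m" for k
  proof (rule poly_eqI_degree[where A = ?X])
    fix z assume "z \<in> ?X"
    then show "poly (\<Sum>x\<in>?X. smult (x ^ k) (L x)) z = poly (monom 1 k) z"
      using fin by (simp add: poly_sum polyL poly_monom if_distrib sum.delta cong: if_cong)
  next
    have "degree (smult (x ^ k) (L x)) < m" if "x \<in> ?X" for x
      using bspec[OF degL that] degree_smult_le le_less_trans by blast
    then show "degree (\<Sum>x\<in>?X. smult (x ^ k) (L x)) < card ?X"
      unfolding card using m by (intro degree_sum_less) auto
    show "degree (monom (1::complex) k) < card ?X"
      using card k by (simp add: degree_monom_eq)
  qed
  define c where "c x = (\<Sum>l<m. coeff (L x) l * s (int l))" for x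
  let ?t = "\<lambda>k. \<Sum>x\<in>?X. c x * x powi k"
  have init: "?t (int k) = s (int k)" if k: "k < m" for k
  proof -
    have "?t (int k) = (\<Sum>x\<in>?X. \<Sum>l<m. s (int l) * (x ^ k * coeff (L x) l))"
      by (simp add: c_def sum_distrib_left sum_distrib_right mult_ac)
    also have "\<dots> = (\<Sum>l<m. s (int l) * coeff (\<Sum>x\<in>?X. smult (x ^ k) (L x)) l)"
      by (subst sum.swap) (simp add: coeff_sum sum_distrib_left)
    also have "\<dots> = s (int k)"
      unfolding expand[OF k] using k by (simp add: if_distrib sum.delta cong: if_cong)
    finally show ?thesis .
  qed
  have "lin_rec ?t m a"
    by (rule lin_rec_sum, rule lin_rec_powi) (use rec_roots_nonzero[of m a] m a1 in auto)
  then have diff: "lin_rec (\<lambda>k. s k - ?t k) m a"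
    by (rule lin_rec_diff[OF rec])
  have "s k - ?t k = 0" for k
    by (rule lin_rec_eq_0[OF diff m a1]) (simp add: init del: power_int_of_nat)
  then have "\<forall>k. s k = ?t k"
    by simp
  then show ?thesis
    by (rule exI[of _ c])
qed

section \<open>The summation formula\<close>

text \<open>
  The powers start at 1 because the window of the theorem starts at \<open>n + 1\<close>. So the
  interpolant must be divisible by the variable \<open>v\<close>; the basis element for the node \<open>y w\<close> is
  \<open>v L(v) / y w\<close> with \<open>L\<close> the usual Lagrange basis polynomial, and this is where \<open>y w \<noteq> 0\<close> enters.
\<close>

lemma interpolate_by_shifted_powers:
  fixes y :: "'a \<Rightarrow> complex" and R :: "'a \<Rightarrow> complex poly"
  assumes fin: "finite X" and card: "card X = m"
    and inj: "inj_on y X" and nz: "\<And>x. x \<in> X \<Longrightarrow> y x \<noteq> 0"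
  shows "\<exists>Q. \<forall>x\<in>X. \<forall>z. (\<Sum>k=1..m. poly (Q k) z * y x ^ k) = poly (R x) z"
proof -
  obtain L where degL: "\<forall>v\<in>y ` X. degree (L v) < m"
    and polyL: "\<forall>v\<in>y ` X. \<forall>w\<in>y ` X. poly (L v) w = (if w = v then 1 else 0)"
    using lagrange_basis_exists[OF finite_imageI[OF fin], of y]
    unfolding card_image[OF inj] card by blast
  define Q where "Q k = (\<Sum>w\<in>X. smult (coeff (L (y w)) (k - 1) / y w) (R w))" for k
  have "(\<Sum>k=1..m. poly (Q k) z * y x ^ k) = poly (R x) z" if x: "x \<in> X" for x z
  proof -
    have "(\<Sum>k=1..m. coeff (L (y w)) (k - 1) * y x ^ k) = y x * poly (L (y w)) (y x)"
      if w: "w \<in> X" for w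
    proof -
      have "(\<Sum>k=1..m. coeff (L (y w)) (k - 1) * y x ^ k)
          = (\<Sum>j<m. coeff (L (y w)) j * y x ^ Suc j)"
        by (rule sum.reindex_bij_witness[of _ Suc "\<lambda>k. k - 1"]) auto
      also have "\<dots> = y x * (\<Sum>j<m. coeff (L (y w)) j * y x ^ j)"
        by (simp add: sum_distrib_left mult_ac)
      also have "(\<Sum>j<m. coeff (L (y w)) j * y x ^ j) = poly (L (y w)) (y x)"
        unfolding poly_altdef using degL w
        by (intro sum.mono_neutral_right) (auto simp: coeff_eq_0)
      finally show ?thesis .
    qed
    note inner = this
    have "(\<Sum>k=1..m. poly (Q k) z * y x ^ k)
        = (\<Sum>k=1..m. \<Sum>w\<in>X. poly (R w) z / y w * (coeff (L (y w)) (k - 1) * y x ^ k))"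
      by (simp add: Q_def poly_sum sum_distrib_left sum_distrib_right mult_ac)
    also have "\<dots> = (\<Sum>w\<in>X. poly (R w) z / y w * (\<Sum>k=1..m. coeff (L (y w)) (k - 1) * y x ^ k))"
      by (subst sum.swap) (simp add: sum_distrib_left)
    also have "\<dots> = (\<Sum>w\<in>X. if w = x then poly (R x) z else 0)"
    proof (intro sum.cong refl)
      fix w assume w: "w \<in> X"
      have "poly (L (y w)) (y x) = (if w = x then 1 else 0)"
        using polyL inj_on_eq_iff[OF inj x w] x w by auto
      then show "poly (R w) z / y w * (\<Sum>k=1..m. coeff (L (y w)) (k - 1) * y x ^ k)
          = (if w = x then poly (R x) z else 0)"
        unfolding inner[OF w] using nz[OF w] nz[OF x] by simp
    qed
    also have "\<dots> = poly (R x) z"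
      using fin x by simp
    finally show ?thesis .
  qed
  then show ?thesis
    by (intro exI[of _ Q] ballI allI)
qed

theorem theorem1p2:
  fixes m :: nat and s :: "int \<Rightarrow> complex" and a :: "nat \<Rightarrow> complex"
    and P :: "complex poly" and h r :: int
  assumes m: "m \<ge> 2"
    and S1: "a 1 \<noteq> 0" "lin_rec s m a"
    and S2: "\<not> (\<exists>d<m. \<exists>b. lin_rec s d b)"
    and S3: "\<exists>i\<in>{1..m}. s (int i) \<noteq> 0"
    and S4: "card (rec_roots m a) = m"
    and h: "h \<noteq> 0"
    and distinct_powers: "inj_on (\<lambda>x. x powi h) (rec_roots m a)"
    and powers_ne_1: "\<forall>x\<in>rec_roots m a. x powi h \<noteq> 1"
  shows "\<exists>Q :: nat \<Rightarrow> complex poly. \<forall>n::nat. n \<ge> 1 \<longrightarrow>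
           (\<Sum>k=1..n. poly P (of_nat k) * s (h * int k + r)) =
           (\<Sum>k=1..m. poly (Q k) (of_nat n) * s ((int n + int k) * h + r))
             + poly (Q (m + 1)) (of_nat n)"
proof -
  let ?X = "rec_roots m a"
  have m1: "m \<ge> 1"
    using m by simp
  have fin: "finite ?X"
    using S4 m1 by (intro card_ge_0_finite) simp
  have nz: "x \<noteq> 0" if "x \<in> ?X" for x
    using rec_roots_nonzero[OF m1 S1(1) that] .
  obtain c where c: "\<And>k. s k = (\<Sum>x\<in>?X. c x * x powi k)"
    using binet_formula[OF S1(2) m1 S1(1) S4] by blast
  define y where "y x = x powi h" for x :: complex
  define b where "b x = c x * x powi r" for x
  have s: "s (h * int k + r) = (\<Sum>x\<in>?X. b x * y x ^ k)" for k
    unfolding c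
  proof (intro sum.cong refl)
    fix x assume "x \<in> ?X"
    then have "x powi (h * int k + r) = y x ^ k * x powi r"
      by (simp only: power_int_add nz power_int_mult power_int_of_nat y_def simp_thms)
    then show "c x * x powi (h * int k + r) = b x * y x ^ k"
      by (simp add: b_def)
  qed
  have "\<forall>x\<in>?X. \<exists>R. \<forall>n::nat. (\<Sum>k=1..n. poly P (of_nat k) * y x ^ k)
      = poly R (of_nat n) * y x ^ n - poly R 0"
    using powers_ne_1 by (intro ballI sum_poly_times_power) (simp add: y_def)
  then obtain R where R: "\<And>x n. x \<in> ?X \<Longrightarrow> (\<Sum>k=1..n. poly P (of_nat k) * y x ^ k)
      = poly (R x) (of_nat n) * y x ^ n - poly (R x) 0"
    by metis
  have "inj_on y ?X" "\<And>x. x \<in> ?X \<Longrightarrow> y x \<noteq> 0"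
    using distinct_powers nz by (simp_all add: y_def [abs_def])
  from interpolate_by_shifted_powers[OF fin S4 this, of R]
  obtain Q where Q: "\<And>x z. x \<in> ?X \<Longrightarrow> (\<Sum>k=1..m. poly (Q k) z * y x ^ k) = poly (R x) z"
    by blast
  define C where "C = (\<Sum>x\<in>?X. b x * poly (R x) 0)"
  have main: "(\<Sum>k=1..n. poly P (of_nat k) * s (h * int k + r))
      = (\<Sum>k=1..m. poly (Q k) (of_nat n) * s ((int n + int k) * h + r)) - C" for n :: nat
  proof -
    have "(\<Sum>k=1..n. poly P (of_nat k) * s (h * int k + r))
        = (\<Sum>x\<in>?X. b x * (\<Sum>k=1..n. poly P (of_nat k) * y x ^ k))"
      unfolding s sum_distrib_left by (subst sum.swap) (simp add: mult_ac)
    also have "\<dots> = (\<Sum>x\<in>?X. b x * (poly (R x) (of_nat n) * y x ^ n)) - C"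
      unfolding C_def sum_subtractf[symmetric] right_diff_distrib[symmetric]
      by (intro sum.cong refl arg_cong2[where f = "(*)"] R)
    also have "(\<Sum>x\<in>?X. b x * (poly (R x) (of_nat n) * y x ^ n))
        = (\<Sum>x\<in>?X. \<Sum>k=1..m. poly (Q k) (of_nat n) * (b x * y x ^ (n + k)))"
    proof (intro sum.cong refl)
      fix x assume "x \<in> ?X"
      show "b x * (poly (R x) (of_nat n) * y x ^ n)
          = (\<Sum>k=1..m. poly (Q k) (of_nat n) * (b x * y x ^ (n + k)))"
        unfolding Q[OF \<open>x \<in> ?X\<close>, symmetric]
        by (simp add: sum_distrib_left sum_distrib_right power_add mult_ac)
    qed
    also have "\<dots> = (\<Sum>k=1..m. poly (Q k) (of_nat n) * s (h * int (n + k) + r))"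
      unfolding s sum_distrib_left by (rule sum.swap)
    also have "\<dots> = (\<Sum>k=1..m. poly (Q k) (of_nat n) * s ((int n + int k) * h + r))"
      by (simp only: of_nat_add mult.commute[of h])
    finally show ?thesis .
  qed
  let ?Q = "Q(m + 1 := [:- C:])"
  have "(\<Sum>k=1..m. poly (?Q k) z * f k) = (\<Sum>k=1..m. poly (Q k) z * f k)" for z f
    by (intro sum.cong) auto
  note same = this
  show ?thesis
  proof (intro exI[of _ ?Q] allI impI)
    fix n :: nat
    show "(\<Sum>k=1..n. poly P (of_nat k) * s (h * int k + r)) =
           (\<Sum>k=1..m. poly (?Q k) (of_nat n) * s ((int n + int k) * h + r))
             + poly (?Q (m + 1)) (of_nat n)"
      unfolding main same fun_upd_same by simp
  qed
qed

end
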